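(* Let $\{\mathsf{N},\mathsf{D}\}\subseteq\Lambda\subseteq\{\mathsf{N},\mathsf{C},\mathsf{D},\mathsf{4}\}$. For any modal formula $A$, the following are equivalent: (1) $A\in L_\Lambda$. (2) $A$ is valid in all closure models satisfying the conditions $(\mathsf{X})$ for all $\mathsf{X}\in\Lambda$.
   Context: Modal formulas are built from propositional variables $p_0,p_1,\ldots$ and $\bot$ by $\neg,\land,\lor,\to,\Box$; $\mathrm{MF}$ is the set of all modal formulas. A modal logic is a set $L\subseteq\mathrm{MF}$ containing all classical tautologies and closed under Modus Ponens and uniform substitution. Consider the rule Nec (from $A$ infer $\Box A$) and the schemes $\mathsf{C}$: $\Box A\land\Box B\to\Box(A\land B)$, $\mathsf{D}$: $\neg(\Box A\land\Box\neg A)$, $\mathsf{4}$: $\Box A\to\Box\Box A$. $L_\Lambda$ is the smallest modal logic that is closed under Nec if $\mathsf{N}\in\Lambda$ and contains all instances of each of $\mathsf{C},\mathsf{D},\mathsf{4}$ belonging to $\Lambda$. A closure operator is a map $\mathrm{cl}:\mathcal{P}(\mathrm{MF})\to\mathcal{P}(\mathrm{MF})$ with $X\subseteq\mathrm{cl}(X)$; $X\subseteq Y\Rightarrow\mathrm{cl}(X)\subseteq\mathrm{cl}(Y)$; $\mathrm{cl}(\mathrm{cl}(X))=\mathrm{cl}(X)$. A closure model $\mathcal{M}=(W,G,\mathrm{cl},\Vdash)$ consists of a non-empty set $W$, a map $G:W\to\mathcal{P}(\mathrm{MF})$, a closure operator $\mathrm{cl}$, and a relation $\Vdash$ between $W$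 and $\mathrm{MF}$ obeying the usual pointwise Boolean clauses for $\bot,\neg,\land,\lor,\to$, and $x\Vdash\Box A\iff A\in\mathrm{cl}(G(x))$. $A$ is valid in $\mathcal{M}$ ($\mathcal{M}\models A$) if $x\Vdash A$ for all $x\in W$. $\mathcal{M}$ satisfies: $(\mathsf{N})$ if for all $x\in W$, $A\in\mathrm{MF}$: $\mathcal{M}\models A$ implies $A\in\mathrm{cl}(G(x))$; $(\mathsf{C})$ if for all $x\in W$, $A,B\in\mathrm{MF}$: $A,B\in\mathrm{cl}(G(x))$ implies $A\land B\in\mathrm{cl}(G(x))$; $(\mathsf{4})$ if for all $x\in W$, $A\in\mathrm{MF}$: $A\in\mathrm{cl}(G(x))$ implies $\Box A\in\mathrm{cl}(G(x))$; $(\mathsf{D})$ if for all $x\in W$, $A\in\mathrm{MF}$: $A\in\mathrm{cl}(G(x))$ implies $\neg A\notin\mathrm{cl}(G(x))$. *)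

theory Defs
  imports Main
begin

datatype fm =
    Var nat
  | Bot
  | Neg fm
  | And fm fm
  | Or fm fm
  | Imp fm fm
  | Box fm

primrec subst :: "(nat \<Rightarrow> fm) \<Rightarrow> fm \<Rightarrow> fm" where
  "subst s (Var n) = s n"
| "subst s Bot = Bot"
| "subst s (Neg A) = Neg (subst s A)"
| "subst s (And A B) = And (subst s A) (subst s B)"
| "subst s (Or A B) = Or (subst s A) (subst s B)"
| "subst s (Imp A B) = Imp (subst s A) (subst s B)"
| "subst s (Box A) = Box (subst s A)"

text \<open>The usual Boolean clauses. Nothing is required of variables and boxed formulas, which
  thus behave as propositional atoms.\<close>

definition boolean :: "(fm \<Rightarrow> bool) \<Rightarrow> bool" where
  "boolean v \<longleftrightarrow>
     \<not> v Bot \<and>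
     (\<forall>A. v (Neg A) \<longleftrightarrow> \<not> v A) \<and>
     (\<forall>A B. v (And A B) \<longleftrightarrow> v A \<and> v B) \<and>
     (\<forall>A B. v (Or A B) \<longleftrightarrow> v A \<or> v B) \<and>
     (\<forall>A B. v (Imp A B) \<longleftrightarrow> (v A \<longrightarrow> v B))"

definition tautology :: "fm \<Rightarrow> bool" where
  "tautology A \<longleftrightarrow> (\<forall>v. boolean v \<longrightarrow> v A)"

definition modal_logic :: "fm set \<Rightarrow> bool" where
  "modal_logic L \<longleftrightarrow>
     (\<forall>A. tautology A \<longrightarrow> A \<in> L) \<and>
     (\<forall>A B. A \<in> L \<longrightarrow> Imp A B \<in> L \<longrightarrow> B \<in> L) \<and>
     (\<forall>A s. A \<in> L \<longrightarrow> subst s A \<in> L)"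

text \<open>Names of the rule Nec (\<open>AxN\<close>) and of the schemes C, D and 4 (\<open>Ax4\<close>).\<close>

datatype ax = AxN | AxC | AxD | Ax4

primrec obeys :: "fm set \<Rightarrow> ax \<Rightarrow> bool" where
  "obeys L AxN \<longleftrightarrow> (\<forall>A. A \<in> L \<longrightarrow> Box A \<in> L)"
| "obeys L AxC \<longleftrightarrow> (\<forall>A B. Imp (And (Box A) (Box B)) (Box (And A B)) \<in> L)"
| "obeys L AxD \<longleftrightarrow> (\<forall>A. Neg (And (Box A) (Box (Neg A))) \<in> L)"
| "obeys L Ax4 \<longleftrightarrow> (\<forall>A. Imp (Box A) (Box (Box A)) \<in> L)"

definition logic_of :: "ax set \<Rightarrow> fm set" where
  "logic_of \<Lambda> = \<Inter> {L. modal_logic L \<and> (\<forall>X\<in>\<Lambda>. obeys L X)}"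

definition closure_operator :: "(fm set \<Rightarrow> fm set) \<Rightarrow> bool" where
  "closure_operator cl \<longleftrightarrow>
     (\<forall>X. X \<subseteq> cl X) \<and>
     (\<forall>X Y. X \<subseteq> Y \<longrightarrow> cl X \<subseteq> cl Y) \<and>
     (\<forall>X. cl (cl X) = cl X)"

text \<open>Only the values of \<open>gen\<close> and \<open>sat\<close> at elements of \<open>worlds\<close> matter.\<close>

record 'w model =
  worlds :: "'w set"
  gen :: "'w \<Rightarrow> fm set"
  clo :: "fm set \<Rightarrow> fm set"
  sat :: "'w \<Rightarrow> fm \<Rightarrow> bool"

definition closure_model :: "'w model \<Rightarrow> bool" where
  "closure_model M \<longleftrightarrow>
     worlds M \<noteq> {} \<and>
     closure_operator (clo M) \<and>
     (\<forall>x\<in>worlds M. boolean (sat M x) \<and>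
        (\<forall>A. sat M x (Box A) \<longleftrightarrow> A \<in> clo M (gen M x)))"

definition valid :: "'w model \<Rightarrow> fm \<Rightarrow> bool" where
  "valid M A \<longleftrightarrow> (\<forall>x\<in>worlds M. sat M x A)"

primrec satisfies :: "'w model \<Rightarrow> ax \<Rightarrow> bool" where
  "satisfies M AxN \<longleftrightarrow>
     (\<forall>x\<in>worlds M. \<forall>A. valid M A \<longrightarrow> A \<in> clo M (gen M x))"
| "satisfies M AxC \<longleftrightarrow>
     (\<forall>x\<in>worlds M. \<forall>A B. A \<in> clo M (gen M x) \<longrightarrow> B \<in> clo M (gen M x) \<longrightarrow>
        And A B \<in> clo M (gen M x))"
| "satisfies M AxD \<longleftrightarrow>
     (\<forall>x\<in>worlds M. \<forall>A. A \<in> clo M (gen M x) \<longrightarrow> Neg A \<notin> clo M (gen M x))"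
| "satisfies M Ax4 \<longleftrightarrow>
     (\<forall>x\<in>worlds M. \<forall>A. A \<in> clo M (gen M x) \<longrightarrow> Box A \<in> clo M (gen M x))"

text \<open>A formula cannot quantify over all types of worlds, so \<open>valid_in_all\<close> takes the type
  \<open>'w\<close> of the worlds as a parameter. The worlds of a model form an arbitrary non-empty set
  of elements of \<open>'w\<close>.\<close>

definition valid_in_all :: "'w itself \<Rightarrow> ax set \<Rightarrow> fm \<Rightarrow> bool" where
  "valid_in_all _ \<Lambda> A \<longleftrightarrow>
     (\<forall>M :: 'w model. closure_model M \<longrightarrow> (\<forall>X\<in>\<Lambda>. satisfies M X) \<longrightarrow> valid M A)"

end

theory Submission
  imports Defs
begin

text \<open>
  Soundness. The formulas valid in one closure model need not be closed under substitution,
  but those all of whose substitution instances are valid form a modal logic. A model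
  satisfying \<open>X\<close> makes this logic obey \<open>X\<close>: instances of C, D and 4 are again instances of the
  same scheme, and for Nec the condition N is applied to each substitution instance separately
  (lemma \<open>logic_of_instance_valid\<close>).

  Completeness. The canonical model has as worlds the maximal consistent extensions of the
  logic, with membership as satisfaction and \<open>G x = {A. Box A \<in> x}\<close>. No relation between worlds
  has to interpret the box, so the identity already serves as closure operator: the clause for
  the box becomes the definition of \<open>G\<close>, and each of the conditions C, D and 4 is the
  corresponding scheme read inside a world. By Lindenbaum's lemma (\<open>lindenbaum\<close>), validity in
  this model is membership in the logic, which reduces the condition N to the rule Nec and
  refutes every non-theorem.
\<close>

section \<open>Classical propositional theories\<close>

lemma tautologyI: "(\<And>v. boolean v \<Longrightarrow> v A) \<Longrightarrow> tautology A"
  unfolding tautology_def by (intro allI impI)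

lemma tautologyD: "tautology A \<Longrightarrow> boolean v \<Longrightarrow> v A"
  unfolding tautology_def by (elim allE[of _ v] impE)

lemma boolean_Imp: "boolean v \<Longrightarrow> v (Imp A B) \<longleftrightarrow> (v A \<longrightarrow> v B)"
  unfolding boolean_def by blast

text \<open>A set of formulas closed under classical propositional consequence.\<close>

definition prop_theory :: "fm set \<Rightarrow> bool" where
  "prop_theory T \<longleftrightarrow>
     (\<forall>A. tautology A \<longrightarrow> A \<in> T) \<and>
     (\<forall>A B. A \<in> T \<longrightarrow> Imp A B \<in> T \<longrightarrow> B \<in> T)"

lemma prop_theory_tautology: "prop_theory T \<Longrightarrow> tautology A \<Longrightarrow> A \<in> T"
  by (simp add: prop_theory_def)

lemma prop_theory_mp: "prop_theory T \<Longrightarrow> Imp A B \<in> T \<Longrightarrow> A \<in> T \<Longrightarrow> B \<in> T"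
  unfolding prop_theory_def by blast

lemma prop_theory_conseq:
  assumes "prop_theory T" "A \<in> T" "\<And>v. boolean v \<Longrightarrow> v A \<Longrightarrow> v B"
  shows "B \<in> T"
proof -
  have "tautology (Imp A B)"
    by (rule tautologyI) (simp add: boolean_Imp assms(3))
  then show ?thesis
    using assms(1,2) prop_theory_tautology prop_theory_mp by blast
qed

lemma prop_theory_conseq2:
  assumes "prop_theory T" "A \<in> T" "B \<in> T" "\<And>v. boolean v \<Longrightarrow> v A \<Longrightarrow> v B \<Longrightarrow> v C"
  shows "C \<in> T"
proof -
  have "Imp B C \<in> T"
    using assms(1,2) by (rule prop_theory_conseq) (simp add: boolean_Imp assms(4))
  then show ?thesis
    using assms(1,3) prop_theory_mp by blast
qed

text \<open>The formulas \<open>C\<close> with \<open>Imp B C \<in> T\<close> are those derivable from \<open>T\<close> with the extra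
  assumption \<open>B\<close>.\<close>

lemma prop_theory_extend:
  assumes "prop_theory T"
  shows "prop_theory {C. Imp B C \<in> T}"
  unfolding prop_theory_def
proof (intro conjI allI impI)
  fix A assume "tautology A"
  then have "tautology (Imp B A)"
    by (intro tautologyI) (simp add: boolean_Imp tautologyD)
  then show "A \<in> {C. Imp B C \<in> T}"
    using assms prop_theory_tautology by blast
next
  fix A C assume "A \<in> {C. Imp B C \<in> T}" "Imp A C \<in> {C. Imp B C \<in> T}"
  then have "Imp B A \<in> T" "Imp B (Imp A C) \<in> T"
    by simp_all
  with assms have "Imp B C \<in> T"
    by (rule prop_theory_conseq2) (simp add: boolean_def)
  then show "C \<in> {C. Imp B C \<in> T}"
    by simp
qed

lemma prop_theory_Union_chain:
  assumes "\<C> \<noteq> {}" "subset.chain \<A> \<C>" "\<And>T. T \<in> \<C> \<Longrightarrow> prop_theory T"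
  shows "prop_theory (\<Union>\<C>)"
  unfolding prop_theory_def
proof (intro conjI allI impI)
  fix A assume "tautology A"
  then show "A \<in> \<Union>\<C>"
    using assms(1,3) prop_theory_tautology by blast
next
  fix A B assume "A \<in> \<Union>\<C>" "Imp A B \<in> \<Union>\<C>"
  then obtain S T where ST: "S \<in> \<C>" "T \<in> \<C>" "A \<in> S" "Imp A B \<in> T"
    by blast
  then have "S \<subseteq> T \<or> T \<subseteq> S"
    using assms(2) by (auto simp: subset_chain_def)
  then obtain U where "U \<in> \<C>" "A \<in> U" "Imp A B \<in> U"
    using ST by blast
  then show "B \<in> \<Union>\<C>"
    using assms(3) prop_theory_mp by blast
qed

section \<open>Maximal consistent sets\<close>

text \<open>A set \<open>x\<close> with \<open>boolean (\<lambda>B. B \<in> x)\<close> is a maximal consistent set: it is the set of formulas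
  true under a Boolean valuation of the propositional atoms.\<close>

lemma lindenbaum:
  assumes "prop_theory L" "A \<notin> L"
  obtains x where "L \<subseteq> x" "boolean (\<lambda>B. B \<in> x)" "A \<notin> x"
proof -
  let ?\<A> = "{T. L \<subseteq> T \<and> prop_theory T \<and> A \<notin> T}"
  have "\<exists>x\<in>?\<A>. \<forall>T\<in>?\<A>. x \<subseteq> T \<longrightarrow> T = x"
  proof (rule subset_Zorn_nonempty)
    show "?\<A> \<noteq> {}"
      using assms by blast
  next
    fix \<C> assume ne: "\<C> \<noteq> {}" and chain: "subset.chain ?\<A> \<C>"
    then have sub: "\<C> \<subseteq> ?\<A>"
      by (simp add: subset_chain_def)
    then have "prop_theory (\<Union>\<C>)"
      using prop_theory_Union_chain[OF ne chain] by blast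
    then show "\<Union>\<C> \<in> ?\<A>"
      using ne sub by blast
  qed
  then obtain x where "x \<in> ?\<A>" and maximal: "\<forall>T\<in>?\<A>. x \<subseteq> T \<longrightarrow> T = x"
    by (rule bexE)
  then have x: "L \<subseteq> x" "prop_theory x" "A \<notin> x"
    by simp_all
  have max: "T = x" if "L \<subseteq> T" "prop_theory T" "A \<notin> T" "x \<subseteq> T" for T
    using maximal that by simp
  \<comment> \<open>By maximality, adding any formula outside \<open>x\<close> makes \<open>A\<close> derivable.\<close>
  have refutes: "Imp B A \<in> x" if "B \<notin> x" for B
  proof (rule ccontr)
    let ?T = "{C. Imp B C \<in> x}"
    assume "Imp B A \<notin> x"
    then have "A \<notin> ?T"
      by simp
    moreover have "x \<subseteq> ?T"
    proof
      fix C assume "C \<in> x"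
      then have "Imp B C \<in> x"
        by (rule prop_theory_conseq[OF x(2)]) (simp add: boolean_Imp)
      then show "C \<in> ?T"
        by simp
    qed
    moreover have "B \<in> ?T"
      using prop_theory_tautology[OF x(2) tautologyI, of "Imp B B"] by (simp add: boolean_Imp)
    ultimately show False
      using max[of ?T] x(1) prop_theory_extend[OF x(2)] \<open>B \<notin> x\<close> by blast
  qed
  have neg: "Neg B \<in> x \<longleftrightarrow> B \<notin> x" for B
  proof
    assume "Neg B \<in> x"
    have "A \<in> x" if "B \<in> x"
      using \<open>Neg B \<in> x\<close> that by (rule prop_theory_conseq2[OF x(2)]) (simp add: boolean_def)
    then show "B \<notin> x"
      using x(3) by blast
  next
    assume "B \<notin> x"
    show "Neg B \<in> x"
    proof (rule ccontr)
      assume "Neg B \<notin> x"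
      then have "Imp (Neg B) A \<in> x" "Imp B A \<in> x"
        using refutes \<open>B \<notin> x\<close> by blast+
      then have "A \<in> x"
        by (rule prop_theory_conseq2[OF x(2)]) (auto simp: boolean_def)
      then show False
        using x(3) by simp
    qed
  qed
  note c1 = prop_theory_conseq[OF x(2)] and c2 = prop_theory_conseq2[OF x(2)]
  have "boolean (\<lambda>B. B \<in> x)"
    unfolding boolean_def
  proof (intro conjI allI)
    show "Bot \<notin> x"
    proof
      assume "Bot \<in> x"
      then have "A \<in> x"
        by (rule c1) (simp add: boolean_def)
      then show False
        using x(3) by simp
    qed
    show "Neg B \<in> x \<longleftrightarrow> B \<notin> x" for B
      by (rule neg)
    show "And B C \<in> x \<longleftrightarrow> B \<in> x \<and> C \<in> x" for B C
    proof (intro iffI conjI)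
      show "B \<in> x" "C \<in> x" if "And B C \<in> x"
        by (rule c1[OF that]; simp add: boolean_def)+
      show "And B C \<in> x" if "B \<in> x \<and> C \<in> x"
        using that[THEN conjunct1] that[THEN conjunct2]
        by (rule c2) (simp add: boolean_def)
    qed
    show "Or B C \<in> x \<longleftrightarrow> B \<in> x \<or> C \<in> x" for B C
    proof
      assume or: "Or B C \<in> x"
      have "C \<in> x" if "Neg B \<in> x"
        using or that by (rule c2) (simp add: boolean_def)
      then show "B \<in> x \<or> C \<in> x"
        using neg by blast
    next
      assume "B \<in> x \<or> C \<in> x"
      then show "Or B C \<in> x"
      proof
        show "Or B C \<in> x" if "B \<in> x"
          using that by (rule c1) (simp add: boolean_def)
        show "Or B C \<in> x" if "C \<in> x"
          using that by (rule c1) (simp add: boolean_def)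
      qed
    qed
    show "Imp B C \<in> x \<longleftrightarrow> (B \<in> x \<longrightarrow> C \<in> x)" for B C
    proof
      assume "Imp B C \<in> x"
      then show "B \<in> x \<longrightarrow> C \<in> x"
        using prop_theory_mp[OF x(2)] by blast
    next
      assume "B \<in> x \<longrightarrow> C \<in> x"
      then have "Neg B \<in> x \<or> C \<in> x"
        using neg by blast
      then show "Imp B C \<in> x"
      proof
        show "Imp B C \<in> x" if "Neg B \<in> x"
          using that by (rule c1) (simp add: boolean_def)
        show "Imp B C \<in> x" if "C \<in> x"
          using that by (rule c1) (simp add: boolean_def)
      qed
    qed
  qed
  then show thesis
    using that x(1,3) by blast
qed

section \<open>The least modal logic and soundness\<close>

lemma modal_logic_prop_theory: "modal_logic L \<Longrightarrow> prop_theory L"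
  unfolding modal_logic_def prop_theory_def by blast

lemma modal_logic_logic_of: "modal_logic (logic_of \<Lambda>)"
  unfolding logic_of_def modal_logic_def by blast

lemma obeys_Inter:
  assumes "\<And>L. L \<in> \<L> \<Longrightarrow> obeys L X"
  shows "obeys (\<Inter>\<L>) X"
  using assms by (cases X) auto

lemma obeys_logic_of: "X \<in> \<Lambda> \<Longrightarrow> obeys (logic_of \<Lambda>) X"
  unfolding logic_of_def by (rule obeys_Inter) blast

lemma logic_of_least:
  "modal_logic L \<Longrightarrow> (\<And>X. X \<in> \<Lambda> \<Longrightarrow> obeys L X) \<Longrightarrow> logic_of \<Lambda> \<subseteq> L"
  unfolding logic_of_def by blast

lemma subst_Var: "subst Var A = A"
  by (induction A) simp_all

lemma subst_subst: "subst s (subst t A) = subst (\<lambda>n. subst s (t n)) A"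
  by (induction A) simp_all

lemma tautology_subst:
  assumes "tautology A"
  shows "tautology (subst s A)"
proof (rule tautologyI)
  fix v assume "boolean v"
  then have "boolean (\<lambda>B. v (subst s B))"
    by (simp add: boolean_def)
  with assms show "v (subst s A)"
    by (rule tautologyD)
qed

lemma logic_of_instance_valid:
  assumes M: "closure_model M" "\<And>X. X \<in> \<Lambda> \<Longrightarrow> satisfies M X"
    and "A \<in> logic_of \<Lambda>"
  shows "valid M (subst s A)"
proof -
  let ?L = "{B. \<forall>s. valid M (subst s B)}"
  have sat: "boolean (sat M x)" "sat M x (Box B) \<longleftrightarrow> B \<in> clo M (gen M x)"
    if "x \<in> worlds M" for x B
    using M(1) that by (simp_all add: closure_model_def)
  have "modal_logic ?L"
    unfolding modal_logic_def
  proof (intro conjI allI impI)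
    show "B \<in> ?L" if "tautology B" for B
      using tautologyD[OF tautology_subst[OF that] sat(1)] by (simp add: valid_def)
    show "C \<in> ?L" if "B \<in> ?L" "Imp B C \<in> ?L" for B C
      using that boolean_Imp[OF sat(1)] by (auto simp: valid_def)
    show "subst t B \<in> ?L" if "B \<in> ?L" for t B
      using that by (simp add: subst_subst)
  qed
  moreover have "obeys ?L X" if "X \<in> \<Lambda>" for X
  proof -
    have "satisfies M X"
      using M(2) that .
    then show ?thesis
      using sat unfolding boolean_def by (cases X) (auto simp: valid_def)
  qed
  ultimately have "logic_of \<Lambda> \<subseteq> ?L"
    by (rule logic_of_least)
  then show ?thesis
    using assms(3) by blast
qed

lemma logic_of_sound:
  assumes "A \<in> logic_of \<Lambda>"
  shows "valid_in_all TYPE('w) \<Lambda> A"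
  unfolding valid_in_all_def
proof (intro allI impI)
  fix M :: "'w model"
  assume "closure_model M" "\<forall>X\<in>\<Lambda>. satisfies M X"
  then have "valid M (subst Var A)"
    using assms by (intro logic_of_instance_valid[of M \<Lambda>]) blast+
  then show "valid M A"
    by (simp add: subst_Var)
qed

section \<open>The canonical model and completeness\<close>

text \<open>The canonical closure model of \<open>L\<close>. Its worlds are the maximal consistent extensions of
  \<open>L\<close>, and its closure operator is the identity.\<close>

definition canonical_model :: "fm set \<Rightarrow> fm set model" where
  "canonical_model L =
     \<lparr>worlds = {x. L \<subseteq> x \<and> boolean (\<lambda>B. B \<in> x)},
      gen = (\<lambda>x. {A. Box A \<in> x}),
      clo = (\<lambda>X. X),
      sat = (\<lambda>x A. A \<in> x)\<rparr>"

lemma valid_canonical_model_iff: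
  assumes "prop_theory L"
  shows "valid (canonical_model L) A \<longleftrightarrow> A \<in> L"
proof
  assume valid: "valid (canonical_model L) A"
  show "A \<in> L"
  proof (rule ccontr)
    assume "A \<notin> L"
    then obtain x where "L \<subseteq> x" "boolean (\<lambda>B. B \<in> x)" "A \<notin> x"
      using lindenbaum[OF assms] by metis
    then show False
      using valid by (simp add: valid_def canonical_model_def)
  qed
qed (auto simp: valid_def canonical_model_def)

text \<open>A formula outside \<open>L\<close> is required because an inconsistent \<open>L\<close> has no worlds.\<close>

lemma closure_model_canonical_model:
  assumes "prop_theory L" "A \<notin> L"
  shows "closure_model (canonical_model L)"
proof -
  obtain x where "L \<subseteq> x" "boolean (\<lambda>B. B \<in> x)"
    using lindenbaum[OF assms] .
  then have "worlds (canonical_model L) \<noteq> {}"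
    by (auto simp: canonical_model_def)
  then show ?thesis
    by (simp add: closure_model_def closure_operator_def canonical_model_def)
qed

lemma satisfies_canonical_model:
  assumes "prop_theory L" "obeys L X"
  shows "satisfies (canonical_model L) X"
proof (cases X)
  case AxN
  then show ?thesis
    using assms valid_canonical_model_iff[OF assms(1)]
    by (auto simp: canonical_model_def)
next
  case AxC
  have "Box (And A B) \<in> x"
    if "L \<subseteq> x" "boolean (\<lambda>B. B \<in> x)" "Box A \<in> x" "Box B \<in> x" for x A B
  proof -
    have "Imp (And (Box A) (Box B)) (Box (And A B)) \<in> x"
      using AxC assms(2) that(1) by auto
    then show ?thesis
      using that by (simp add: boolean_def)
  qed
  then show ?thesis
    using AxC by (simp add: canonical_model_def)
next
  case AxD
  have "Box (Neg A) \<notin> x"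
    if "L \<subseteq> x" "boolean (\<lambda>B. B \<in> x)" "Box A \<in> x" for x A
  proof -
    have "Neg (And (Box A) (Box (Neg A))) \<in> x"
      using AxD assms(2) that(1) by auto
    then show ?thesis
      using that by (simp add: boolean_def)
  qed
  then show ?thesis
    using AxD by (simp add: canonical_model_def)
next
  case Ax4
  have "Box (Box A) \<in> x"
    if "L \<subseteq> x" "boolean (\<lambda>B. B \<in> x)" "Box A \<in> x" for x A
  proof -
    have "Imp (Box A) (Box (Box A)) \<in> x"
      using Ax4 assms(2) that(1) by auto
    then show ?thesis
      using that by (simp add: boolean_def)
  qed
  then show ?thesis
    using Ax4 by (simp add: canonical_model_def)
qed

lemma logic_of_complete:
  assumes "valid_in_all TYPE(fm set) \<Lambda> A"
  shows "A \<in> logic_of \<Lambda>"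
proof (rule ccontr)
  assume notin: "A \<notin> logic_of \<Lambda>"
  let ?M = "canonical_model (logic_of \<Lambda>)"
  have thy: "prop_theory (logic_of \<Lambda>)"
    using modal_logic_logic_of by (rule modal_logic_prop_theory)
  have "closure_model ?M"
    using thy notin by (rule closure_model_canonical_model)
  moreover have "\<forall>X\<in>\<Lambda>. satisfies ?M X"
    using satisfies_canonical_model[OF thy] obeys_logic_of by blast
  ultimately have "valid ?M A"
    using assms by (simp add: valid_in_all_def)
  then show False
    using notin valid_canonical_model_iff[OF thy] by simp
qed

theorem theorem3p21:
  fixes \<Lambda> :: "ax set" and A :: fm
  assumes "{AxN, AxD} \<subseteq> \<Lambda>" and "\<Lambda> \<subseteq> {AxN, AxC, AxD, Ax4}"
  shows "(A \<in> logic_of \<Lambda> \<longleftrightarrow> valid_in_all TYPE(fm set) \<Lambda> A) \<and>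
         (A \<in> logic_of \<Lambda> \<longrightarrow> valid_in_all TYPE('w) \<Lambda> A)"
proof (intro conjI iffI impI)
  show "A \<in> logic_of \<Lambda>" if "valid_in_all TYPE(fm set) \<Lambda> A"
    using that by (rule logic_of_complete)
qed (rule logic_of_sound, assumption)+

end
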